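(* In the signature $(+,\cdot,0)$, the finite set $\mathcal B_m$ is an identity basis for $A_m$ for every $m\ge 1$, and the finite set $\mathcal B_\infty$ is an identity basis for $A_\infty$.
   Context: For $m\ge1$, $A_m=\{0\}\cup\{[i,j]:0\le i<j\le m\}$ ($i,j$ integers), with flat addition ($x+x=x$, and $x+y=0$ whenever $x\neq y$) and multiplication $[i,j][k,l]=[i,l]$ if $j=k$, $[i,j][k,l]=0$ if $j\ne k$, and products with $0$ equal to $0$. $A_\infty$ is defined by the same operations on $\{0\}\cup\{[i,j]:i,j\in\mathbb N_0,\ i<j\}$, $\mathbb N_0$ being the nonnegative integers. Both are considered in the signature $(+,\cdot,0)$, the constant being interpreted as the element $0$. The finite set of identities $\mathcal C$ consists of the six ai-semiring axioms (addition associative, commutative, idempotent; multiplication associative; both distributive laws), the three identities $0+x\approx0$, $0x\approx0$, $x0\approx0$, and the following: (M) $uxv+pxq\approx uxv+pxq+uxq$; (R) $uv+pv+pq\approx uv+pv+pq+uq$; (L) $xu+vxz\approx0$; (E) $ux+vxz\approx0$; with the following convention, where different letters denote distinct variables and "omitted" means deleted from the written word. In (M), each of $u,v,p,q$ is, independently, either present as a variable or omitted, while $x$ is never omitted (sixteen identities). In (R) nothing is omitted. In (L), $v$ is not omitted, while $u,z$ may be omitted independently (four identities). In (E), $z$ is not omitted, while $u,v$ may be omitted independently (four identities). For $m\ge1$, $\mathcal B_m$ is $\mathcal C$ together with $(N_m)$ $x_1\cdots x_{m+1}\approx0$ and $(H_m)$ $x_1\cdots x_m+y_1\cdots y_m\approx(x_1+y_1)\cdots(x_m+y_m)$.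 $\mathcal B_\infty$ is $\mathcal C$ together with the two identities $x^2\approx0$ and $xyx\approx0$. A set of identities is an identity basis for an algebra if all its members hold in the algebra and every identity (in the given signature) valid in the algebra is derivable from it in equational logic. *)

theory Defs
  imports Main
begin

text \<open>Terms of the signature \<open>(+, \<cdot>, 0)\<close> over the countable set of variables \<open>Var 0, Var 1, \<dots>\<close>.\<close>

datatype trm =
    Var nat
  | Zero ("\<^bold>0")
  | Add trm trm (infixl "\<^bold>+" 65)
  | Mul trm trm (infixl "\<^bold>*" 70)

type_synonym identity = "trm \<times> trm"

abbreviation ident :: "trm \<Rightarrow> trm \<Rightarrow> identity" (infix "\<approx>" 50) where
  "s \<approx> t \<equiv> (s, t)"

primrec subst :: "(nat \<Rightarrow> trm) \<Rightarrow> trm \<Rightarrow> trm" where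
  "subst \<sigma> (Var n) = \<sigma> n"
| "subst \<sigma> \<^bold>0 = \<^bold>0"
| "subst \<sigma> (s \<^bold>+ t) = subst \<sigma> s \<^bold>+ subst \<sigma> t"
| "subst \<sigma> (s \<^bold>* t) = subst \<sigma> s \<^bold>* subst \<sigma> t"

inductive derivable :: "identity set \<Rightarrow> trm \<Rightarrow> trm \<Rightarrow> bool" for E where
  ax: "(s \<approx> t) \<in> E \<Longrightarrow> derivable E (subst \<sigma> s) (subst \<sigma> t)"
| refl: "derivable E t t"
| sym: "derivable E s t \<Longrightarrow> derivable E t s"
| trans: "derivable E s t \<Longrightarrow> derivable E t r \<Longrightarrow> derivable E s r"
| add_cong: "derivable E s s' \<Longrightarrow> derivable E t t' \<Longrightarrow> derivable E (s \<^bold>+ t) (s' \<^bold>+ t')"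
| mul_cong: "derivable E s s' \<Longrightarrow> derivable E t t' \<Longrightarrow> derivable E (s \<^bold>* t) (s' \<^bold>* t')"

record 'a algebra =
  carrier :: "'a set"
  add :: "'a \<Rightarrow> 'a \<Rightarrow> 'a"
  mul :: "'a \<Rightarrow> 'a \<Rightarrow> 'a"
  zer :: 'a

primrec eval :: "'a algebra \<Rightarrow> (nat \<Rightarrow> 'a) \<Rightarrow> trm \<Rightarrow> 'a" where
  "eval A h (Var n) = h n"
| "eval A h \<^bold>0 = zer A"
| "eval A h (s \<^bold>+ t) = add A (eval A h s) (eval A h t)"
| "eval A h (s \<^bold>* t) = mul A (eval A h s) (eval A h t)"

definition valid_in :: "'a algebra \<Rightarrow> identity \<Rightarrow> bool" where
  "valid_in A e \<longleftrightarrow>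
     (\<forall>h. (\<forall>n. h n \<in> carrier A) \<longrightarrow> eval A h (fst e) = eval A h (snd e))"

definition is_identity_basis :: "'a algebra \<Rightarrow> identity set \<Rightarrow> bool" where
  "is_identity_basis A B \<longleftrightarrow>
     (\<forall>e\<in>B. valid_in A e) \<and> (\<forall>s t. valid_in A (s \<approx> t) \<longrightarrow> derivable B s t)"


text \<open>\<open>Intv i j\<close> stands for \<open>[i,j]\<close>; the condition \<open>i < j\<close> is part of the carriers below.\<close>

datatype elt = Null | Intv nat nat

definition flat_add :: "elt \<Rightarrow> elt \<Rightarrow> elt" where
  "flat_add a b = (if a = b then a else Null)"

fun intv_mul :: "elt \<Rightarrow> elt \<Rightarrow> elt" where
  "intv_mul (Intv i j) (Intv k l) = (if j = k then Intv i l else Null)"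
| "intv_mul Null _ = Null"
| "intv_mul _ Null = Null"

definition A_fin :: "nat \<Rightarrow> elt algebra" where
  "A_fin m = \<lparr>carrier = {Null} \<union> {Intv i j | i j. i < j \<and> j \<le> m},
              add = flat_add, mul = intv_mul, zer = Null\<rparr>"

definition A_inf :: "elt algebra" where
  "A_inf = \<lparr>carrier = {Null} \<union> {Intv i j | i j. i < j},
            add = flat_add, mul = intv_mul, zer = Null\<rparr>"


text \<open>The product, bracketed to the left, of a nonempty list of terms; it is only applied to
  nonempty lists.\<close>

definition word :: "trm list \<Rightarrow> trm" where
  "word ts = foldl (\<^bold>*) (hd ts) (tl ts)"

text \<open>A variable that may be present or omitted in a word.\<close>

abbreviation opt :: "trm \<Rightarrow> trm list set" where
  "opt t \<equiv> {[t], []}"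

abbreviation (input) "vx \<equiv> Var 0"
abbreviation (input) "vy \<equiv> Var 1"
abbreviation (input) "vz \<equiv> Var 2"
abbreviation (input) "vu \<equiv> Var 3"
abbreviation (input) "vv \<equiv> Var 4"
abbreviation (input) "vp \<equiv> Var 5"
abbreviation (input) "vq \<equiv> Var 6"

definition ai_semiring_axioms :: "identity set" where
  "ai_semiring_axioms =
    {(vx \<^bold>+ vy) \<^bold>+ vz \<approx> vx \<^bold>+ (vy \<^bold>+ vz),
     vx \<^bold>+ vy \<approx> vy \<^bold>+ vx,
     vx \<^bold>+ vx \<approx> vx,
     (vx \<^bold>* vy) \<^bold>* vz \<approx> vx \<^bold>* (vy \<^bold>* vz),
     vx \<^bold>* (vy \<^bold>+ vz) \<approx> vx \<^bold>* vy \<^bold>+ vx \<^bold>* vz,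
     (vx \<^bold>+ vy) \<^bold>* vz \<approx> vx \<^bold>* vz \<^bold>+ vy \<^bold>* vz}"

definition zero_axioms :: "identity set" where
  "zero_axioms = {\<^bold>0 \<^bold>+ vx \<approx> \<^bold>0, \<^bold>0 \<^bold>* vx \<approx> \<^bold>0, vx \<^bold>* \<^bold>0 \<approx> \<^bold>0}"

definition M_identities :: "identity set" where
  "M_identities =
    {word (u @ [vx] @ v) \<^bold>+ word (p @ [vx] @ q) \<approx>
       word (u @ [vx] @ v) \<^bold>+ word (p @ [vx] @ q) \<^bold>+ word (u @ [vx] @ q)
     | u v p q. u \<in> opt vu \<and> v \<in> opt vv \<and> p \<in> opt vp \<and> q \<in> opt vq}"

definition R_identity :: identity where
  "R_identity =
    (vu \<^bold>* vv \<^bold>+ vp \<^bold>* vv \<^bold>+ vp \<^bold>* vq \<approx>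
       vu \<^bold>* vv \<^bold>+ vp \<^bold>* vv \<^bold>+ vp \<^bold>* vq \<^bold>+ vu \<^bold>* vq)"

definition L_identities :: "identity set" where
  "L_identities =
    {word ([vx] @ u) \<^bold>+ word ([vv] @ [vx] @ z) \<approx> \<^bold>0 | u z. u \<in> opt vu \<and> z \<in> opt vz}"

definition E_identities :: "identity set" where
  "E_identities =
    {word (u @ [vx]) \<^bold>+ word (v @ [vx] @ [vz]) \<approx> \<^bold>0 | u v. u \<in> opt vu \<and> v \<in> opt vv}"

definition C_identities :: "identity set" where
  "C_identities =
    ai_semiring_axioms \<union> zero_axioms \<union> M_identities \<union> {R_identity}
      \<union> L_identities \<union> E_identities"

definition N_identity :: "nat \<Rightarrow> identity" where
  "N_identity m = (word (map Var [1..<m+2]) \<approx> \<^bold>0)"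

text \<open>Here \<open>x\<^sub>i\<close> is \<open>Var i\<close> and \<open>y\<^sub>i\<close> is \<open>Var (m + i)\<close>, for \<open>1 \<le> i \<le> m\<close>.\<close>

definition H_identity :: "nat \<Rightarrow> identity" where
  "H_identity m =
    (word (map Var [1..<m+1]) \<^bold>+ word (map (\<lambda>i. Var (m + i)) [1..<m+1]) \<approx>
       word (map (\<lambda>i. Var i \<^bold>+ Var (m + i)) [1..<m+1]))"

definition B_fin :: "nat \<Rightarrow> identity set" where
  "B_fin m = C_identities \<union> {N_identity m, H_identity m}"

definition B_inf :: "identity set" where
  "B_inf = C_identities \<union> {vx \<^bold>* vx \<approx> \<^bold>0, vx \<^bold>* vy \<^bold>* vx \<approx> \<^bold>0}"

end

theory Submission imports Defs begin

text \<open>Modulo the ai-semiring axioms a term is a finite sum of words, and a word \<open>w\<close> is absorbed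
  by a term \<open>s\<close> when \<open>s \<approx> s + w\<close> is derivable. Unless \<open>s \<approx> 0\<close> is derivable, the set \<open>W\<close> of words
  absorbed by \<open>s\<close> is closed under (M) and (R) and avoids the patterns of (L) and (E). This forces
  \<open>W\<close> to be exactly the set of source-to-sink paths of an acyclic graph whose edges are the
  variables and whose vertices are the residuals of \<open>W\<close>. A potential on the vertices, strictly
  increasing along edges and bounded by \<open>m\<close>, sends each variable to an interval and so gives an
  assignment in \<open>A\<^sub>m\<close> under which all words of \<open>W\<close> take the same nonzero value. Potentials given by
  weighted longest paths separate any two vertices, except two vertices on the same level of paths
  of length \<open>m\<close>, and those are identified by (H). Hence a word taking the value of \<open>s\<close> under all
  these assignments is a path, so it is absorbed by \<open>s\<close>; for a valid identity \<open>s \<approx> t\<close> each side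
  absorbs the other. Over \<open>A\<^sub>\<infinity>\<close> absorbed words have no repeated letter, so a large \<open>m\<close>
  makes the exceptional case void.\<close>

section \<open>Derivability as an order\<close>

lemma subst_word: "ts \<noteq> [] \<Longrightarrow> subst \<sigma> (word ts) = word (map (subst \<sigma>) ts)"
proof -
  have "subst \<sigma> (foldl (\<^bold>*) t ts) = foldl (\<^bold>*) (subst \<sigma> t) (map (subst \<sigma>) ts)" for t ts
    by (induction ts arbitrary: t) auto
  then show "ts \<noteq> [] \<Longrightarrow> ?thesis"
    by (cases ts) (auto simp: word_def)
qed

lemma word_singleton [simp]: "word [t] = t"
  by (simp add: word_def)

lemma word_snoc: "ts \<noteq> [] \<Longrightarrow> word (ts @ [t]) = word ts \<^bold>* t"
  by (cases ts) (auto simp: word_def)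

text \<open>A variable can be replaced only by a single term, so a context word is packed into one
  letter; the empty word stands for an omitted letter.\<close>

definition block :: "trm list \<Rightarrow> trm list" where
  "block ts = (if ts = [] then [] else [word ts])"

locale C_theory =
  fixes E :: "identity set"
  assumes C_subset: "C_identities \<subseteq> E"
begin

abbreviation eqv :: "trm \<Rightarrow> trm \<Rightarrow> bool" (infix "\<sim>" 50) where
  "s \<sim> t \<equiv> derivable E s t"

text \<open>The semilattice order. Zero is its greatest element, so zero lies below \<open>s\<close>
  exactly when \<open>s\<close> is derivably zero.\<close>

definition below :: "trm \<Rightarrow> trm \<Rightarrow> bool" (infix "\<sqsubseteq>" 50) where
  "s \<sqsubseteq> t \<longleftrightarrow> t \<sim> t \<^bold>+ s"

lemma instance_of_C: "(l \<approx> r) \<in> C_identities \<Longrightarrow> subst \<sigma> l \<sim> subst \<sigma> r"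
  using C_subset by (blast intro: derivable.ax)

lemma instance_of_M:
    "(l \<approx> r) \<in> M_identities \<Longrightarrow> subst \<sigma> l \<sim> subst \<sigma> r"
  and instance_of_R: "R_identity = (l \<approx> r) \<Longrightarrow> subst \<sigma> l \<sim> subst \<sigma> r"
  and instance_of_L: "(l \<approx> r) \<in> L_identities \<Longrightarrow> subst \<sigma> l \<sim> subst \<sigma> r"
  and instance_of_E: "(l \<approx> r) \<in> E_identities \<Longrightarrow> subst \<sigma> l \<sim> subst \<sigma> r"
  by (simp_all add: instance_of_C C_identities_def)

lemma instance_of_basic:
  "(l \<approx> r) \<in> ai_semiring_axioms \<union> zero_axioms \<Longrightarrow> subst \<sigma> l \<sim> subst \<sigma> r"
  by (rule instance_of_C) (auto simp: C_identities_def)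

lemma add_assoc: "(a \<^bold>+ b) \<^bold>+ c \<sim> a \<^bold>+ (b \<^bold>+ c)"
  using instance_of_basic[of "(vx \<^bold>+ vy) \<^bold>+ vz" "vx \<^bold>+ (vy \<^bold>+ vz)" "(!) [a, b, c]"]
  by (simp add: ai_semiring_axioms_def)

lemma add_commute: "a \<^bold>+ b \<sim> b \<^bold>+ a"
  using instance_of_basic[of "vx \<^bold>+ vy" "vy \<^bold>+ vx" "(!) [a, b]"]
  by (simp add: ai_semiring_axioms_def)

lemma add_idem: "a \<^bold>+ a \<sim> a"
  using instance_of_basic[of "vx \<^bold>+ vx" "vx" "(!) [a]"]
  by (simp add: ai_semiring_axioms_def)

lemma mul_assoc: "(a \<^bold>* b) \<^bold>* c \<sim> a \<^bold>* (b \<^bold>* c)"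
  using instance_of_basic[of "(vx \<^bold>* vy) \<^bold>* vz" "vx \<^bold>* (vy \<^bold>* vz)" "(!) [a, b, c]"]
  by (simp add: ai_semiring_axioms_def)

lemma distrib_left: "a \<^bold>* (b \<^bold>+ c) \<sim> a \<^bold>* b \<^bold>+ a \<^bold>* c"
  using instance_of_basic[of "vx \<^bold>* (vy \<^bold>+ vz)" "vx \<^bold>* vy \<^bold>+ vx \<^bold>* vz" "(!) [a, b, c]"]
  by (simp add: ai_semiring_axioms_def)

lemma distrib_right: "(a \<^bold>+ b) \<^bold>* c \<sim> a \<^bold>* c \<^bold>+ b \<^bold>* c"
  using instance_of_basic[of "(vx \<^bold>+ vy) \<^bold>* vz" "vx \<^bold>* vz \<^bold>+ vy \<^bold>* vz" "(!) [a, b, c]"]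
  by (simp add: ai_semiring_axioms_def)

lemma zero_add: "\<^bold>0 \<^bold>+ a \<sim> \<^bold>0"
  using instance_of_basic[of "\<^bold>0 \<^bold>+ vx" "\<^bold>0" "(!) [a]"] by (simp add: zero_axioms_def)

lemma zero_mul: "\<^bold>0 \<^bold>* a \<sim> \<^bold>0"
  using instance_of_basic[of "\<^bold>0 \<^bold>* vx" "\<^bold>0" "(!) [a]"] by (simp add: zero_axioms_def)

lemma mul_zero: "a \<^bold>* \<^bold>0 \<sim> \<^bold>0"
  using instance_of_basic[of "vx \<^bold>* \<^bold>0" "\<^bold>0" "(!) [a]"] by (simp add: zero_axioms_def)

lemmas eqv_trans [trans] = derivable.trans

lemma below_refl [simp]: "a \<sqsubseteq> a"
  unfolding below_def by (rule derivable.sym[OF add_idem])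

lemma add_upper1: "a \<sqsubseteq> a \<^bold>+ b"
  unfolding below_def
proof -
  have "a \<^bold>+ b \<sim> (a \<^bold>+ a) \<^bold>+ b"
    by (intro derivable.add_cong derivable.refl derivable.sym[OF add_idem])
  also have "\<dots> \<sim> a \<^bold>+ (a \<^bold>+ b)" by (rule add_assoc)
  also have "\<dots> \<sim> (a \<^bold>+ b) \<^bold>+ a" by (rule add_commute)
  finally show "a \<^bold>+ b \<sim> (a \<^bold>+ b) \<^bold>+ a" .
qed

lemma below_trans [trans]:
  assumes "a \<sqsubseteq> b" "b \<sqsubseteq> c"
  shows "a \<sqsubseteq> c"
proof -
  have "c \<sim> c \<^bold>+ b" using assms(2) by (simp add: below_def)
  also have "\<dots> \<sim> c \<^bold>+ (b \<^bold>+ a)"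
    using assms(1) by (intro derivable.add_cong derivable.refl) (simp add: below_def)
  also have "\<dots> \<sim> (c \<^bold>+ b) \<^bold>+ a" by (rule derivable.sym[OF add_assoc])
  also have "\<dots> \<sim> c \<^bold>+ a"
    using assms(2) by (intro derivable.add_cong derivable.refl) (simp add: below_def derivable.sym)
  finally show ?thesis by (simp add: below_def)
qed

lemma eqv_imp_below: 
  assumes "a \<sim> b" shows "a \<sqsubseteq> b"
  unfolding below_def
proof -
  have "b \<sim> b \<^bold>+ b" by (rule derivable.sym[OF add_idem])
  also have "\<dots> \<sim> b \<^bold>+ a" by (intro derivable.add_cong derivable.refl derivable.sym[OF assms])
  finally show "b \<sim> b \<^bold>+ a" .
qed

lemma eqv_imp_above: "a \<sim> b \<Longrightarrow> b \<sqsubseteq> a"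
  by (rule eqv_imp_below) (rule derivable.sym)

lemma below_antisym: "a \<sqsubseteq> b \<Longrightarrow> b \<sqsubseteq> a \<Longrightarrow> a \<sim> b"
  unfolding below_def
  by (rule derivable.trans[OF _ derivable.trans[OF add_commute derivable.sym]])

lemma add_upper2: "b \<sqsubseteq> a \<^bold>+ b"
  using add_upper1 add_commute eqv_imp_below below_trans by blast

lemma add_least:
  assumes "a \<sqsubseteq> c" "b \<sqsubseteq> c"
  shows "a \<^bold>+ b \<sqsubseteq> c"
  unfolding below_def
proof -
  have "c \<sim> c \<^bold>+ b" using assms(2) by (simp add: below_def)
  also have "\<dots> \<sim> (c \<^bold>+ a) \<^bold>+ b"
    using assms(1) by (intro derivable.add_cong derivable.refl) (simp add: below_def)
  also have "\<dots> \<sim> c \<^bold>+ (a \<^bold>+ b)" by (rule add_assoc)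
  finally show "c \<sim> c \<^bold>+ (a \<^bold>+ b)" .
qed

lemma mul_mono:
  assumes "a \<sqsubseteq> a'" "b \<sqsubseteq> b'"
  shows "a \<^bold>* b \<sqsubseteq> a' \<^bold>* b'"
proof (rule below_trans)
  have "a' \<^bold>* b \<sim> (a' \<^bold>+ a) \<^bold>* b"
    using assms(1) by (intro derivable.mul_cong derivable.refl) (simp add: below_def)
  also have "\<dots> \<sim> a' \<^bold>* b \<^bold>+ a \<^bold>* b" by (rule distrib_right)
  finally show "a \<^bold>* b \<sqsubseteq> a' \<^bold>* b" by (simp add: below_def)
  have "a' \<^bold>* b' \<sim> a' \<^bold>* (b' \<^bold>+ b)"
    using assms(2) by (intro derivable.mul_cong derivable.refl) (simp add: below_def)
  also have "\<dots> \<sim> a' \<^bold>* b' \<^bold>+ a' \<^bold>* b" by (rule distrib_left)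
  finally show "a' \<^bold>* b \<sqsubseteq> a' \<^bold>* b'" by (simp add: below_def)
qed

lemma below_zero: "a \<sqsubseteq> \<^bold>0"
  unfolding below_def by (rule derivable.sym[OF zero_add])

lemma eqv_zero_iff: "a \<sim> \<^bold>0 \<longleftrightarrow> \<^bold>0 \<sqsubseteq> a"
  using below_antisym below_zero eqv_imp_above by blast

lemma word_append:
  assumes "as \<noteq> []" "bs \<noteq> []"
  shows "word (as @ bs) \<sim> word as \<^bold>* word bs"
  using assms(2)
proof (induction bs rule: rev_nonempty_induct)
  case (single b)
  then show ?case using assms(1) by (simp add: word_snoc derivable.refl)
next
  case (snoc b bs)
  have "word (as @ bs @ [b]) = word (as @ bs) \<^bold>* b"
    using assms(1) word_snoc[of "as @ bs"] by simp
  also have "\<dots> \<sim> (word as \<^bold>* word bs) \<^bold>* b"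
    by (intro derivable.mul_cong derivable.refl snoc)
  also have "\<dots> \<sim> word as \<^bold>* (word bs \<^bold>* b)" by (rule mul_assoc)
  finally show ?case using snoc by (simp add: word_snoc)
qed

text \<open>Words are bracketed to the left, so an inner factor need not be a subterm;
  \<open>word_append\<close> isolates it. Empty contexts are split off because they have no
  product.\<close>

lemma word_mono_infix:
  assumes "bs \<noteq> []" "bs' \<noteq> []" "word bs \<sqsubseteq> word bs'"
  shows "word (as @ bs @ cs) \<sqsubseteq> word (as @ bs' @ cs)"
proof -
  have suffix: "word (bs @ cs) \<sqsubseteq> word (bs' @ cs)"
  proof (cases "cs = []")
    case False
    have "word (bs @ cs) \<sqsubseteq> word bs \<^bold>* word cs"
      by (intro eqv_imp_below word_append assms False)
    also have "\<dots> \<sqsubseteq> word bs' \<^bold>* word cs" by (intro mul_mono assms below_refl)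
    also have "\<dots> \<sqsubseteq> word (bs' @ cs)" by (intro eqv_imp_above word_append assms False)
    finally show ?thesis .
  qed (use assms in simp)
  show ?thesis
  proof (cases "as = []")
    case False
    have "word (as @ (bs @ cs)) \<sqsubseteq> word as \<^bold>* word (bs @ cs)"
      by (intro eqv_imp_below word_append False) (simp add: assms)
    also have "\<dots> \<sqsubseteq> word as \<^bold>* word (bs' @ cs)" by (intro mul_mono suffix below_refl)
    also have "\<dots> \<sqsubseteq> word (as @ (bs' @ cs))"
      by (intro eqv_imp_above word_append False) (simp add: assms)
    finally show ?thesis .
  qed (use suffix in simp)
qed

lemma word_mono:
  assumes "list_all2 below as bs" "as \<noteq> []"
  shows "word as \<sqsubseteq> word bs"
  using assms
proof (induction as arbitrary: bs rule: rev_induct)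
  case (snoc a as)
  then obtain b cs where bs: "bs = cs @ [b]" "list_all2 below as cs" "a \<sqsubseteq> b"
    by (auto simp: list_all2_append1 list_all2_Cons1)
  show ?case
  proof (cases "as = []")
    case True
    then show ?thesis using bs by simp
  next
    case False
    then have "cs \<noteq> []" using bs by auto
    then show ?thesis using bs False snoc.IH by (simp add: word_snoc mul_mono)
  qed
qed simp

lemma zero_infix:
  assumes "bs \<noteq> []" "\<^bold>0 \<sqsubseteq> word bs"
  shows "\<^bold>0 \<sqsubseteq> word (as @ bs @ cs)"
proof -
  have suffix: "\<^bold>0 \<sqsubseteq> word (bs @ cs)"
  proof (cases "cs = []")
    case False
    have "\<^bold>0 \<sqsubseteq> \<^bold>0 \<^bold>* word cs" by (rule eqv_imp_above[OF zero_mul])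
    also have "\<dots> \<sqsubseteq> word bs \<^bold>* word cs" by (intro mul_mono assms below_refl)
    also have "\<dots> \<sqsubseteq> word (bs @ cs)" by (intro eqv_imp_above word_append assms False)
    finally show ?thesis .
  qed (use assms in simp)
  show ?thesis
  proof (cases "as = []")
    case False
    have "\<^bold>0 \<sqsubseteq> word as \<^bold>* \<^bold>0" by (rule eqv_imp_above[OF mul_zero])
    also have "\<dots> \<sqsubseteq> word as \<^bold>* word (bs @ cs)" by (intro mul_mono suffix below_refl)
    also have "\<dots> \<sqsubseteq> word (as @ (bs @ cs))"
      by (intro eqv_imp_above word_append False) (simp add: assms)
    finally show ?thesis .
  qed (use suffix in simp)
qed

lemma word_block_below: "word (as @ block ts @ cs) \<sqsubseteq> word (as @ ts @ cs)"
  and word_block_above: "word (as @ ts @ cs) \<sqsubseteq> word (as @ block ts @ cs)"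
proof -
  have "word (as @ block ts @ cs) \<sqsubseteq> word (as @ ts @ cs) \<and>
      word (as @ ts @ cs) \<sqsubseteq> word (as @ block ts @ cs)" if "ts \<noteq> []"
    using that unfolding block_def by (simp only: if_False) (intro conjI word_mono_infix; simp)
  then show "word (as @ block ts @ cs) \<sqsubseteq> word (as @ ts @ cs)"
    "word (as @ ts @ cs) \<sqsubseteq> word (as @ block ts @ cs)"
    by (cases "ts = []"; simp add: block_def)+
qed

lemma word_blocks_below: "word (block u @ [x] @ block v) \<sqsubseteq> word (u @ [x] @ v)"
  using word_block_below[of "[]" u "[x] @ block v"] word_block_below[of "u @ [x]" v "[]"]
  by (auto intro: below_trans)

lemma word_blocks_above: "word (u @ [x] @ v) \<sqsubseteq> word (block u @ [x] @ block v)"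
  using word_block_above[of "[]" u "[x] @ block v"] word_block_above[of "u @ [x]" v "[]"]
  by (auto intro: below_trans)

section \<open>The special laws with words in place of variables\<close>

lemma M_below:
  assumes "word (u @ [x] @ v) \<sqsubseteq> s" "word (p @ [x] @ q) \<sqsubseteq> s"
  shows "word (u @ [x] @ q) \<sqsubseteq> s"
proof -
  \<comment> \<open>The list is indexed by variable number; entries 1 and 2 are fillers for
    \<open>vy\<close> and \<open>vz\<close>.\<close>
  let ?\<sigma> = "(!) [x, x, x, word u, word v, word p, word q]"
  \<comment> \<open>The variant of (M) is selected by which of the four context words are
    empty.\<close>
  define pick where "pick = (\<lambda>(ts :: trm list) t. if ts = [] then [] else [t :: trm])"
  have mem: "pick ts t \<in> opt t" for ts t by (simp add: pick_def)
  have pick: "map (subst ?\<sigma>) (pick u vu) = block u" "map (subst ?\<sigma>) (pick v vv) = block v"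
    "map (subst ?\<sigma>) (pick p vp) = block p" "map (subst ?\<sigma>) (pick q vq) = block q"
    by (auto simp: pick_def block_def)
  have "(word (pick u vu @ [vx] @ pick v vv) \<^bold>+ word (pick p vp @ [vx] @ pick q vq) \<approx>
       word (pick u vu @ [vx] @ pick v vv) \<^bold>+ word (pick p vp @ [vx] @ pick q vq) \<^bold>+
         word (pick u vu @ [vx] @ pick q vq)) \<in> M_identities"
    unfolding M_identities_def using mem by blast
  then have "word (block u @ [x] @ block v) \<^bold>+ word (block p @ [x] @ block q) \<sim>
       word (block u @ [x] @ block v) \<^bold>+ word (block p @ [x] @ block q) \<^bold>+
         word (block u @ [x] @ block q)"
    by (drule_tac instance_of_M[of _ _ ?\<sigma>]) (simp add: subst_word pick)
  then have "word (block u @ [x] @ block q) \<sqsubseteq>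
      word (block u @ [x] @ block v) \<^bold>+ word (block p @ [x] @ block q)"
    by (simp add: below_def)
  moreover have "\<dots> \<sqsubseteq> s"
    by (intro add_least below_trans[OF word_blocks_below] assms)
  ultimately show ?thesis
    by (blast intro: below_trans word_blocks_above)
qed

lemma R_below:
  assumes "u \<^bold>* v \<sqsubseteq> s" "p \<^bold>* v \<sqsubseteq> s" "p \<^bold>* q \<sqsubseteq> s"
  shows "u \<^bold>* q \<sqsubseteq> s"
proof -
  let ?\<sigma> = "(!) [u, u, u, u, v, p, q]"
  have "u \<^bold>* v \<^bold>+ p \<^bold>* v \<^bold>+ p \<^bold>* q \<sim> u \<^bold>* v \<^bold>+ p \<^bold>* v \<^bold>+ p \<^bold>* q \<^bold>+ u \<^bold>* q"
    using instance_of_R[OF R_identity_def, of ?\<sigma>] by simp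
  then have "u \<^bold>* q \<sqsubseteq> u \<^bold>* v \<^bold>+ p \<^bold>* v \<^bold>+ p \<^bold>* q" by (simp add: below_def)
  also have "\<dots> \<sqsubseteq> s" by (intro add_least assms)
  finally show ?thesis .
qed

lemma L_below:
  assumes "word ([x] @ u) \<sqsubseteq> s" "word (v @ [x] @ z) \<sqsubseteq> s" "v \<noteq> []"
  shows "\<^bold>0 \<sqsubseteq> s"
proof -
  let ?\<sigma> = "(!) [x, x, word z, word u, word v]"
  define pick where "pick = (\<lambda>(ts :: trm list) t. if ts = [] then [] else [t :: trm])"
  have mem: "pick ts t \<in> opt t" for ts t by (simp add: pick_def)
  have pick: "map (subst ?\<sigma>) (pick u vu) = block u" "map (subst ?\<sigma>) (pick z vz) = block z"
    by (auto simp: pick_def block_def)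
  have "(word ([vx] @ pick u vu) \<^bold>+ word ([vv] @ [vx] @ pick z vz) \<approx> \<^bold>0) \<in> L_identities"
    unfolding L_identities_def using mem by blast
  then have "word (block [] @ [x] @ block u) \<^bold>+ word (block v @ [x] @ block z) \<sim> \<^bold>0"
    by (drule_tac instance_of_L[of _ _ ?\<sigma>])
      (use assms(3) in \<open>simp add: subst_word pick block_def del: word_singleton\<close>)
  then have "\<^bold>0 \<sqsubseteq> word (block [] @ [x] @ block u) \<^bold>+ word (block v @ [x] @ block z)"
    by (simp add: eqv_zero_iff)
  also have "\<dots> \<sqsubseteq> s"
    by (intro add_least below_trans[OF word_blocks_below]) (use assms in auto)
  finally show ?thesis .
qed

lemma E_below:
  assumes "word (u @ [x]) \<sqsubseteq> s" "word (v @ [x] @ z) \<sqsubseteq> s" "z \<noteq> []"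
  shows "\<^bold>0 \<sqsubseteq> s"
proof -
  let ?\<sigma> = "(!) [x, x, word z, word u, word v]"
  define pick where "pick = (\<lambda>(ts :: trm list) t. if ts = [] then [] else [t :: trm])"
  have mem: "pick ts t \<in> opt t" for ts t by (simp add: pick_def)
  have pick: "map (subst ?\<sigma>) (pick u vu) = block u" "map (subst ?\<sigma>) (pick v vv) = block v"
    by (auto simp: pick_def block_def)
  have "(word (pick u vu @ [vx]) \<^bold>+ word (pick v vv @ [vx] @ [vz]) \<approx> \<^bold>0) \<in> E_identities"
    unfolding E_identities_def using mem by blast
  then have "word (block u @ [x] @ block []) \<^bold>+ word (block v @ [x] @ block z) \<sim> \<^bold>0"
    by (drule_tac instance_of_E[of _ _ ?\<sigma>])
      (use assms(3) in \<open>simp add: subst_word pick block_def del: word_singleton\<close>)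
  then have "\<^bold>0 \<sqsubseteq> word (block u @ [x] @ block []) \<^bold>+ word (block v @ [x] @ block z)"
    by (simp add: eqv_zero_iff)
  also have "\<dots> \<sqsubseteq> s"
    by (intro add_least below_trans[OF word_blocks_below]) (use assms in auto)
  finally show ?thesis .
qed

text \<open>The factor \<open>[x] @ b @ [x]\<close> serves as both summands of (L): it starts with
  \<open>x\<close>, and \<open>x\<close> also occurs in it after a nonempty word. So it is zero, and
  so is any word around it.\<close>

lemma repeated_below:
  assumes "word (a @ [x] @ b @ [x] @ c) \<sqsubseteq> s"
  shows "\<^bold>0 \<sqsubseteq> s"
proof -
  have zero: "\<^bold>0 \<sqsubseteq> word ([x] @ b @ [x])"
    by (rule L_below[of x "b @ [x]" _ "[x] @ b" "[]"]) simp_all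
  have "\<^bold>0 \<sqsubseteq> word (a @ ([x] @ b @ [x]) @ c)" by (rule zero_infix[OF _ zero]) simp
  then show ?thesis using assms below_trans by simp
qed

end

section \<open>Residuals and potentials\<close>

text \<open>For a nonempty list this says that its product is \<open>Intv i j\<close>. The empty
  list acts as a stationary path, so that chains split at every position.\<close>

fun chain :: "nat \<Rightarrow> elt list \<Rightarrow> nat \<Rightarrow> bool" where
  "chain i [] j \<longleftrightarrow> i = j"
| "chain i (a # as) j \<longleftrightarrow> (\<exists>k. a = Intv i k \<and> chain k as j)"

lemma chain_append: "chain i (as @ bs) j \<longleftrightarrow> (\<exists>k. chain i as k \<and> chain k bs j)"
  by (induction as arbitrary: i) auto

lemma chain_fun: "chain i as j \<Longrightarrow> chain i as k \<Longrightarrow> j = k"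
  by (induction as arbitrary: i) auto

text \<open>\<open>H\<close> is the trace of (H) on the words of maximal length; it is void when all words are shorter
  than \<open>m\<close>.\<close>

locale path_language =
  fixes W :: "nat list set" and m :: nat
  assumes nonempty: "W \<noteq> {}" and Nil_notin: "[] \<notin> W"
    and M: "u @ x # v \<in> W \<Longrightarrow> p @ x # q \<in> W \<Longrightarrow> u @ x # q \<in> W"
    and R: "u @ v \<in> W \<Longrightarrow> p @ v \<in> W \<Longrightarrow> p @ q \<in> W \<Longrightarrow>
      u \<noteq> [] \<Longrightarrow> v \<noteq> [] \<Longrightarrow> p \<noteq> [] \<Longrightarrow> q \<noteq> [] \<Longrightarrow> u @ q \<in> W"
    and L: "x # u \<in> W \<Longrightarrow> v @ x # z \<in> W \<Longrightarrow> v = []"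
    and E: "u @ [x] \<in> W \<Longrightarrow> v @ x # z \<in> W \<Longrightarrow> z = []"
    and length_le: "w \<in> W \<Longrightarrow> length w \<le> m"
    and H: "u @ v \<in> W \<Longrightarrow> u' @ v' \<in> W \<Longrightarrow> length u = length u' \<Longrightarrow> length v = length v' \<Longrightarrow>
      length (u @ v) = m \<Longrightarrow> u' @ v \<in> W"
begin

section \<open>Residuals as vertices of the path graph\<close>

definition Res :: "nat list \<Rightarrow> nat list set" where
  "Res u = {v. u @ v \<in> W}"

lemma Res_append: "Res u = Res u' \<Longrightarrow> Res (u @ w) = Res (u' @ w)"
  by (auto simp: Res_def set_eq_iff)

text \<open>By (E), the last letter of a word in \<open>W\<close> is last wherever it occurs; so all
  words end in one sink.\<close>

lemma Res_final: "w \<in> W \<Longrightarrow> Res w = {[]}"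
proof -
  assume w: "w \<in> W"
  with Nil_notin obtain a x where wa: "w = a @ [x]"
    by (metis rev_exhaust)
  show ?thesis using w E[of a x a] by (auto simp: Res_def wa)
qed

text \<open>(R) carries every continuation of one prefix over to the other. It needs nonempty
  factors, so an empty prefix is handled by (L) and an empty continuation by
  \<open>Res_final\<close>.\<close>

lemma Res_eq_if_meet:
  assumes "u @ v \<in> W" "u' @ v \<in> W"
  shows "Res u = Res u'"
proof (cases v)
  case Nil
  then show ?thesis using assms Res_final by simp
next
  case (Cons x r)
  then have no: "u \<notin> W" "u' \<notin> W"
    using assms Res_final by (auto simp: Res_def set_eq_iff)
  show ?thesis
  proof (cases "u = [] \<or> u' = []")
    case True
    then have "u = u'" using assms L Cons by (metis append_Nil)
    then show ?thesis by simp
  next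
    case False
    have "q \<in> Res u \<longleftrightarrow> q \<in> Res u'" for q
      using R[of u v u' q] R[of u' v u q] assms False no Cons
      by (cases "q = []") (auto simp: Res_def)
    then show ?thesis by blast
  qed
qed

text \<open>(M) crosses two occurrences of a letter and so produces a common continuation. Together
  with \<open>Res_right\<close> this gives each letter, as an edge, a fixed source and
  target.\<close>

lemma Res_left:
  assumes "u @ x # v \<in> W" "p @ x # q \<in> W"
  shows "Res u = Res p"
  using M[OF assms] assms by (intro Res_eq_if_meet)

lemma Res_right:
  assumes "u @ x # v \<in> W" "p @ x # q \<in> W"
  shows "Res (u @ [x]) = Res (p @ [x])"
  using M[OF assms] assms by (intro Res_eq_if_meet[of _ q]) auto

section \<open>Potentials and the assignments they induce\<close>

definition potential :: "(nat list set \<Rightarrow> nat) \<Rightarrow> bool" where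
  "potential \<phi> \<longleftrightarrow>
     (\<forall>u x v. u @ x # v \<in> W \<longrightarrow> \<phi> (Res u) < \<phi> (Res (u @ [x]))) \<and>
     (\<forall>u v. u @ v \<in> W \<longrightarrow> \<phi> (Res u) \<le> m)"

text \<open>Any occurrence of the letter may serve: \<open>Res_left\<close> and
  \<open>Res_right\<close> make the endpoints independent of the choice. A letter outside the graph
  gets \<open>Null\<close>, which occurs in no chain.\<close>

definition assignment :: "(nat list set \<Rightarrow> nat) \<Rightarrow> nat \<Rightarrow> elt" where
  "assignment \<phi> x =
     (if \<exists>u v. u @ x # v \<in> W
      then let u = SOME u. \<exists>v. u @ x # v \<in> W in Intv (\<phi> (Res u)) (\<phi> (Res (u @ [x])))
      else Null)"

lemma assignment_eq:
  assumes "u @ x # v \<in> W"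
  shows "assignment \<phi> x = Intv (\<phi> (Res u)) (\<phi> (Res (u @ [x])))"
proof -
  define p where "p = (SOME u. \<exists>v. u @ x # v \<in> W)"
  have "\<exists>q. p @ x # q \<in> W" unfolding p_def by (rule someI_ex) (use assms in blast)
  then obtain q where "p @ x # q \<in> W" ..
  then show ?thesis
    using Res_left[OF assms] Res_right[OF assms] assms
    by (auto simp: assignment_def Let_def simp flip: p_def)
qed

lemma assignment_carrier:
  assumes "potential \<phi>"
  shows "assignment \<phi> x \<in> carrier (A_fin m)"
proof (cases "\<exists>u v. u @ x # v \<in> W")
  case True
  then obtain u v where uv: "u @ x # v \<in> W" by blast
  then have "\<phi> (Res (u @ [x])) \<le> m"
    using assms by (auto simp: potential_def dest!: spec[of _ "u @ [x]"])
  then show ?thesis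
    using uv assms assignment_eq[OF uv] by (auto simp: A_fin_def potential_def)
qed (auto simp: assignment_def A_fin_def)

lemma chain_assignment:
  "u @ w @ v \<in> W \<Longrightarrow> chain (\<phi> (Res u)) (map (assignment \<phi>) w) (\<phi> (Res (u @ w)))"
proof (induction w arbitrary: u)
  case (Cons x w)
  then show ?case using Cons.IH[of "u @ [x]"] assignment_eq[of u x "w @ v"] by auto
qed simp

lemma chain_word:
  "w \<in> W \<Longrightarrow> chain (\<phi> (Res [])) (map (assignment \<phi>) w) (\<phi> {[]})"
  using chain_assignment[of "[]" w "[]"] Res_final by simp

section \<open>Weighted longest paths as potentials\<close>

definition longest :: "(nat list \<Rightarrow> nat) \<Rightarrow> nat list set \<Rightarrow> nat" where
  "longest g S = Max {g u | u. Res u = S}"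

context
  fixes g :: "nat list \<Rightarrow> nat"
  assumes g_le: "\<forall>u v. u @ v \<in> W \<longrightarrow> g u \<le> m"
begin

text \<open>A word with the residual of a prefix is itself a prefix, so \<open>g_le\<close> bounds
  its weight.\<close>

lemma finite_weights:
  assumes "u @ v \<in> W"
  shows "finite {g u' | u'. Res u' = Res u}"
proof -
  have "{g u' | u'. Res u' = Res u} \<subseteq> {..m}"
    using g_le assms by (auto simp: Res_def set_eq_iff)
  then show ?thesis by (rule finite_subset) simp
qed

lemma le_longest: "u @ v \<in> W \<Longrightarrow> Res u' = Res u \<Longrightarrow> g u' \<le> longest g (Res u)"
  unfolding longest_def using finite_weights by (intro Max_ge) auto

lemma longest_attained:
  assumes "u @ v \<in> W"
  obtains u' where "Res u' = Res u" "longest g (Res u) = g u'"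
proof -
  have "longest g (Res u) \<in> {g u' | u'. Res u' = Res u}"
    unfolding longest_def by (rule Max_in) (use finite_weights[OF assms] in auto)
  then show ?thesis using that by auto
qed

text \<open>A heaviest word to the source of an edge, extended by that edge, competes for the
  maximum at the target. The bound holds because the maximum is attained at a prefix of a word in
  \<open>W\<close>.\<close>

lemma potential_longest:
  assumes g_less: "\<And>u x. g u < g (u @ [x])"
  shows "potential (longest g)"
  unfolding potential_def
proof (intro conjI allI impI)
  fix u v assume uv: "u @ v \<in> W"
  then obtain u' where u': "Res u' = Res u" "longest g (Res u) = g u'"
    by (rule longest_attained)
  then have "u' @ v \<in> W" using uv by (auto simp: Res_def set_eq_iff)
  then show "longest g (Res u) \<le> m" using u'(2) g_le by (simp) blast
next
  fix u x v assume uv: "u @ x # v \<in> W"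
  then obtain u' where u': "Res u' = Res u" "longest g (Res u) = g u'"
    by (rule longest_attained)
  then have "Res (u' @ [x]) = Res (u @ [x])" by (intro Res_append)
  then have "g (u' @ [x]) \<le> longest g (Res (u @ [x]))"
    using uv by (intro le_longest[of _ v]) auto
  then show "longest g (Res u) < longest g (Res (u @ [x]))"
    using g_less[of u' x] u' by simp
qed

end

lemma length_prefix_le: "\<forall>u v. u @ v \<in> W \<longrightarrow> length u \<le> m"
  using length_le by fastforce

lemma potential_length: "potential (longest length)"
  using length_prefix_le by (rule potential_longest) simp

text \<open>Inserting one extra edge at the vertex \<open>Res u\<close> raises it above every other vertex of the same
  level, and there is room for this unless \<open>Res u\<close> lies on a path of length \<open>m\<close>.\<close>

lemma separate_same_level:
  assumes uv: "u @ v \<in> W" and uv': "u' @ v' \<in> W" and neq: "Res u \<noteq> Res u'"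
    and level: "longest length (Res u) = longest length (Res u')"
    and short: "\<And>w. w \<in> Res u \<Longrightarrow> longest length (Res u) + length w < m"
  shows "\<exists>\<phi>. potential \<phi> \<and> \<phi> (Res u) \<noteq> \<phi> (Res u')"
proof -
  \<comment> \<open>Words that pass through or end at the vertex \<open>Res u\<close> count one
    extra.\<close>
  define g where "g a = length a + (if \<exists>b c. a = b @ c \<and> Res b = Res u then 1 else 0)" for a
  have "g a \<le> m" if "a @ d \<in> W" for a d
  proof (cases "\<exists>b c. a = b @ c \<and> Res b = Res u")
    case True
    then obtain b c where bc: "a = b @ c" "Res b = Res u" by blast
    then have "c @ d \<in> Res u" using that by (auto simp: Res_def set_eq_iff)
    then have "longest length (Res u) + length (c @ d) < m" by (rule short)
    moreover have "length b \<le> longest length (Res u)"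
      using uv bc by (intro le_longest[of length, OF length_prefix_le]) auto
    ultimately show ?thesis using bc by (auto simp: g_def)
  next
    case False
    then show ?thesis using that length_prefix_le by (auto simp: g_def)
  qed
  then have g_le: "\<forall>a d. a @ d \<in> W \<longrightarrow> g a \<le> m" by blast
  have g_less: "g a < g (a @ [x])" for a x
  proof -
    have "\<exists>b c. a @ [x] = b @ c \<and> Res b = Res u" if "\<exists>b c. a = b @ c \<and> Res b = Res u"
      using that by (metis append_assoc)
    then show ?thesis unfolding g_def by auto
  qed
  obtain u0 where u0: "Res u0 = Res u" "longest length (Res u) = length u0"
    using longest_attained[of length, OF length_prefix_le uv] by blast
  have "g u0 = length u0 + 1" using u0 by (auto simp: g_def)
  then have "longest length (Res u) < longest g (Res u)"
    using le_longest[of g, OF g_le uv u0(1)] u0 by simp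
  moreover have "longest g (Res u') \<le> longest length (Res u')"
  proof -
    obtain a where a: "Res a = Res u'" "longest g (Res u') = g a"
      using longest_attained[of g, OF g_le uv'] by blast
    \<comment> \<open>Otherwise the part of \<open>a\<close> after that vertex, attached to
      \<open>u0\<close>, would put \<open>Res u'\<close> on a higher level than
      \<open>Res u\<close>.\<close>
    have "\<not> (\<exists>b c. a = b @ c \<and> Res b = Res u)"
    proof
      assume "\<exists>b c. a = b @ c \<and> Res b = Res u"
      then obtain b c where bc: "a = b @ c" "Res b = Res u" by blast
      then have "c \<noteq> []" using a neq by auto
      have "Res (u0 @ c) = Res u'" using bc a u0 Res_append[of u0 b c] by simp
      then have "length (u0 @ c) \<le> longest length (Res u')"
        using uv' by (intro le_longest[of length, OF length_prefix_le]) auto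
      then show False using level u0 \<open>c \<noteq> []\<close> by simp
    qed
    then have "g a = length a" by (simp add: g_def)
    also have "\<dots> \<le> longest length (Res u')"
      using uv' a by (intro le_longest[of length, OF length_prefix_le]) auto
    finally show ?thesis using a by simp
  qed
  moreover have "potential (longest g)"
    using g_le g_less by (rule potential_longest)
  ultimately show ?thesis using level by (intro exI[of _ "longest g"]) simp
qed

text \<open>Different levels are separated by \<open>longest length\<close>. On a common level, if
  raising neither vertex works, both lie on paths of length \<open>m\<close>; (H) then gives them a
  common continuation.\<close>

lemma separate:
  assumes uv: "u @ v \<in> W" and uv': "u' @ v' \<in> W" and neq: "Res u \<noteq> Res u'"
  shows "\<exists>\<phi>. potential \<phi> \<and> \<phi> (Res u) \<noteq> \<phi> (Res u')"
proof (cases "longest length (Res u) = longest length (Res u')")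
  case False
  then show ?thesis using potential_length by blast
next
  case True
  show ?thesis
  proof (rule ccontr)
    assume *: "\<not> ?thesis"
    have "\<exists>w\<in>Res u. \<not> longest length (Res u) + length w < m"
      using * separate_same_level[OF uv uv' neq True] by blast
    then obtain w where w: "w \<in> Res u" "longest length (Res u) + length w \<ge> m" by force
    have "\<exists>w\<in>Res u'. \<not> longest length (Res u') + length w < m"
      using * separate_same_level[OF uv' uv neq[symmetric] True[symmetric]] by metis
    then obtain w' where w': "w' \<in> Res u'" "longest length (Res u') + length w' \<ge> m" by force
    obtain a where a: "Res a = Res u" "longest length (Res u) = length a"
      using longest_attained[of length, OF length_prefix_le uv] by blast
    obtain a' where a': "Res a' = Res u'" "longest length (Res u') = length a'"
      using longest_attained[of length, OF length_prefix_le uv'] by blast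
    have aw: "a @ w \<in> W" "a' @ w' \<in> W" using a a' w w' by (auto simp: Res_def set_eq_iff)
    then have "length (a @ w) \<le> m" "length (a' @ w') \<le> m" by (auto dest: length_le)
    then have "a' @ w \<in> W" using aw w w' a a' True by (intro H[of a w a' w']) auto
    then have "Res a = Res a'" using aw by (intro Res_eq_if_meet)
    then show False using a a' neq by simp
  qed
qed

text \<open>Reading \<open>w\<close> from the left never leaves the graph: the source of the next
  letter has the same potentials as the vertex reached, so \<open>separate\<close> identifies the
  two. The same argument puts the final vertex at the sink.\<close>

lemma mem_if_chain:
  assumes "\<And>\<phi>. potential \<phi> \<Longrightarrow> chain (\<phi> (Res [])) (map (assignment \<phi>) w) (\<phi> {[]})"
  shows "w \<in> W"
proof -
  have sep: "Res u = Res u'"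
    if "u @ v \<in> W" "u' @ v' \<in> W" "\<And>\<phi>. potential \<phi> \<Longrightarrow> \<phi> (Res u) = \<phi> (Res u')" for u v u' v'
    using separate that by blast
  have prefix: "\<exists>v. a @ v \<in> W" if "w = a @ b" for a b
    using that
  proof (induction a arbitrary: b rule: rev_induct)
    case Nil
    then show ?case using nonempty by auto
  next
    case (snoc x a)
    then obtain v where v: "a @ v \<in> W" by force
    have left: "\<exists>k. assignment \<phi> x = Intv (\<phi> (Res a)) k" if pot: "potential \<phi>" for \<phi>
    proof -
      obtain i k where "chain (\<phi> (Res [])) (map (assignment \<phi>) a) i" "assignment \<phi> x = Intv i k"
        using assms[OF pot] snoc.prems by (auto simp: chain_append)
      moreover have "chain (\<phi> (Res [])) (map (assignment \<phi>) a) (\<phi> (Res a))"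
        using chain_assignment[of "[]" a v] v by simp
      ultimately show ?thesis using chain_fun by blast
    qed
    \<comment> \<open>One potential suffices here: if \<open>x\<close> were not an edge, it would be
      sent to \<open>Null\<close>.\<close>
    obtain p q where pq: "p @ x # q \<in> W"
      using left[OF potential_length] by (auto simp: assignment_def split: if_splits)
    have "Res a = Res p"
      using v pq by (rule sep) (use left assignment_eq[OF pq] in fastforce)
    then have "a @ x # q \<in> W" using pq by (auto simp: Res_def set_eq_iff)
    then show ?case by auto
  qed
  obtain v where v: "w @ v \<in> W" using prefix[of w "[]"] by auto
  obtain w0 where w0: "w0 \<in> W" using nonempty by auto
  have "Res w = Res w0"
  proof (rule sep)
    show "w @ v \<in> W" "w0 @ [] \<in> W" using v w0 by auto
    fix \<phi> assume "potential \<phi>"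
    then have "chain (\<phi> (Res [])) (map (assignment \<phi>) w) (\<phi> (Res w0))"
      using assms Res_final[OF w0] by simp
    moreover have "chain (\<phi> (Res [])) (map (assignment \<phi>) w) (\<phi> (Res w))"
      using chain_assignment[of "[]" w v \<phi>] v by simp
    ultimately show "\<phi> (Res w) = \<phi> (Res w0)" by (rule chain_fun[symmetric])
  qed
  then have "[] \<in> Res w" using Res_final[OF w0] by simp
  then show "w \<in> W" by (simp add: Res_def)
qed

end

section \<open>Validity of the identities\<close>

text \<open>Only nonzero values are compared: a nonzero sum or product has nonzero parts, which
  reduces identities to equations between endpoints.\<close>

lemma elt_eqI: "(\<And>i j. a = Intv i j \<longleftrightarrow> b = Intv i j) \<Longrightarrow> a = b"
  by (cases a; cases b) auto

lemma flat_add_eq_Intv [simp]: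
  "flat_add a b = Intv i j \<longleftrightarrow> a = Intv i j \<and> b = Intv i j"
  by (auto simp: flat_add_def)

lemma intv_mul_eq_Intv [simp]:
  "intv_mul a b = Intv i j \<longleftrightarrow> (\<exists>k. a = Intv i k \<and> b = Intv k j)"
  by (cases a; cases b) auto

lemma A_inf_simps [simp]: "add A_inf = flat_add" "mul A_inf = intv_mul" "zer A_inf = Null"
  by (simp_all add: A_inf_def)

lemma eval_A_fin: "eval (A_fin m) h t = eval A_inf h t"
  by (induction t) (simp_all add: A_fin_def)

lemma carrier_A_fin_subset: "carrier (A_fin m) \<subseteq> carrier A_inf"
  by (auto simp: A_fin_def A_inf_def)

lemma valid_in_A_fin: "valid_in A_inf e \<Longrightarrow> valid_in (A_fin m) e"
  using carrier_A_fin_subset by (fastforce simp: valid_in_def eval_A_fin)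

lemma eval_word_eq_Intv:
  "ts \<noteq> [] \<Longrightarrow> eval A_inf h (word ts) = Intv i j \<longleftrightarrow> chain i (map (eval A_inf h) ts) j"
  by (induction ts arbitrary: j rule: rev_nonempty_induct) (auto simp: word_snoc chain_append)

lemma chain_Var: "chain i (map (eval A_inf h) (map Var w)) j \<longleftrightarrow> chain i (map h w) j"
  by (simp add: comp_def)

lemma valid_in_A_infI:
  assumes "\<And>h i j. (\<And>n i j. h n = Intv i j \<Longrightarrow> i < j) \<Longrightarrow>
    eval A_inf h s = Intv i j \<longleftrightarrow> eval A_inf h t = Intv i j"
  shows "valid_in A_inf (s \<approx> t)"
  unfolding valid_in_def
proof (intro allI impI)
  fix h :: "nat \<Rightarrow> elt"
  assume h: "\<forall>n. h n \<in> carrier A_inf"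
  have "i < j" if "h n = Intv i j" for n i j
    using h[rule_format, of n] that by (auto simp: A_inf_def)
  then have "eval A_inf h s = eval A_inf h t"
    by (intro elt_eqI assms)
  then show "eval A_inf h (fst (s \<approx> t)) = eval A_inf h (snd (s \<approx> t))" by simp
qed

lemma valid_C: "e \<in> C_identities \<Longrightarrow> valid_in A_inf e"
proof -
  have "valid_in A_inf e" if "e \<in> ai_semiring_axioms \<union> zero_axioms" for e
    using that unfolding ai_semiring_axioms_def zero_axioms_def
    by (elim UnE insertE emptyE) (auto intro!: valid_in_A_infI)
  moreover have "valid_in A_inf (word (u @ [vx] @ v) \<^bold>+ word (p @ [vx] @ q) \<approx>
      word (u @ [vx] @ v) \<^bold>+ word (p @ [vx] @ q) \<^bold>+ word (u @ [vx] @ q))" for u v p q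
    by (rule valid_in_A_infI) (auto simp: eval_word_eq_Intv chain_append)
  then have "valid_in A_inf e" if "e \<in> M_identities" for e
    using that unfolding M_identities_def by blast
  moreover have "valid_in A_inf R_identity"
    unfolding R_identity_def by (rule valid_in_A_infI) auto
  moreover have "valid_in A_inf (word ([vx] @ u) \<^bold>+ word ([vv] @ [vx] @ z) \<approx> \<^bold>0)" for u z
  proof (rule valid_in_A_infI)
    fix h :: "nat \<Rightarrow> elt" and i j
    assume less: "\<And>n i j. h n = Intv i j \<Longrightarrow> i < j"
    show "eval A_inf h (word ([vx] @ u) \<^bold>+ word ([vv] @ [vx] @ z)) = Intv i j \<longleftrightarrow>
        eval A_inf h \<^bold>0 = Intv i j"
      \<comment> \<open>Both summands and \<open>x\<close> start at \<open>i\<close>, so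
        \<open>Var 4\<close> in front of \<open>x\<close> would be \<open>Intv i i\<close>.\<close>
      using less[of 4 i i] by (auto simp: eval_word_eq_Intv)
  qed
  then have "valid_in A_inf e" if "e \<in> L_identities" for e
    using that unfolding L_identities_def by blast
  moreover have "valid_in A_inf (word (u @ [vx]) \<^bold>+ word (v @ [vx] @ [vz]) \<approx> \<^bold>0)" for u v
  proof (rule valid_in_A_infI)
    fix h :: "nat \<Rightarrow> elt" and i j
    assume less: "\<And>n i j. h n = Intv i j \<Longrightarrow> i < j"
    show "eval A_inf h (word (u @ [vx]) \<^bold>+ word (v @ [vx] @ [vz])) = Intv i j \<longleftrightarrow>
        eval A_inf h \<^bold>0 = Intv i j"
      \<comment> \<open>Dually, \<open>Var 2\<close> behind \<open>x\<close> would be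
        \<open>Intv j j\<close>.\<close>
      using less[of 2 j j] by (auto simp: eval_word_eq_Intv chain_append)
  qed
  then have "valid_in A_inf e" if "e \<in> E_identities" for e
    using that unfolding E_identities_def by blast
  ultimately show "e \<in> C_identities \<Longrightarrow> ?thesis"
    unfolding C_identities_def by blast
qed

lemma valid_B_inf: "e \<in> B_inf \<Longrightarrow> valid_in A_inf e"
proof -
  have "valid_in A_inf (vx \<^bold>* vx \<approx> \<^bold>0)" "valid_in A_inf (vx \<^bold>* vy \<^bold>* vx \<approx> \<^bold>0)"
  proof (rule_tac [!] valid_in_A_infI)
    fix h :: "nat \<Rightarrow> elt" and i j
    assume less: "\<And>n i j. h n = Intv i j \<Longrightarrow> i < j"
    show "eval A_inf h (vx \<^bold>* vx) = Intv i j \<longleftrightarrow> eval A_inf h \<^bold>0 = Intv i j"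
      using less[of 0] by auto
    show "eval A_inf h (vx \<^bold>* vy \<^bold>* vx) = Intv i j \<longleftrightarrow> eval A_inf h \<^bold>0 = Intv i j"
      using less[of 0 i j] less[of 1 j i] by auto
  qed
  then show "e \<in> B_inf \<Longrightarrow> ?thesis"
    using valid_C[of e] by (auto simp: B_inf_def)
qed

section \<open>Chains of maximal length in \<open>A_fin\<close>\<close>

lemma chain_bounds:
  assumes "chain i as j" "set as \<subseteq> carrier (A_fin m)"
  shows "i + length as \<le> j" "as \<noteq> [] \<Longrightarrow> j \<le> m"
  using assms by (induction as arbitrary: i) (fastforce simp: A_fin_def)+

text \<open>Each interval advances by at least one, so a chain with as many factors as its total
  length consists of unit intervals, and these are determined by the start.\<close>

lemma chain_tight:
  assumes "chain i as j" "chain i bs j" "length as = length bs" "j = i + length as"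
    and "set as \<union> set bs \<subseteq> carrier (A_fin m)"
  shows "as = bs"
  using assms
proof (induction as arbitrary: i bs)
  case (Cons a as)
  then obtain b bs' where bs: "bs = b # bs'" by (cases bs) auto
  with Cons.prems obtain k l where kl: "a = Intv i k" "chain k as j" "b = Intv i l" "chain l bs' j"
    by auto
  have "i < k" "i < l" using Cons.prems kl bs by (auto simp: A_fin_def)
  moreover have "k + length as \<le> j" "l + length bs' \<le> j"
    using chain_bounds(1)[OF kl(2), of m] chain_bounds(1)[OF kl(4), of m] Cons.prems bs by auto
  ultimately have "k = Suc i" "l = Suc i" using Cons.prems bs by auto
  then show ?case using Cons.IH[of k bs'] Cons.prems kl bs by auto
qed simp

lemma chain_flat_add:
  "chain i (map (\<lambda>r. flat_add (f r) (g r)) rs) j \<longleftrightarrow>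
    map f rs = map g rs \<and> chain i (map f rs) j"
  by (induction rs arbitrary: i) auto

lemma valid_N: "valid_in (A_fin m) (N_identity m)"
  unfolding valid_in_def
proof (intro allI impI)
  fix h :: "nat \<Rightarrow> elt"
  assume h: "\<forall>n. h n \<in> carrier (A_fin m)"
  have "\<not> chain i (map h [1..<m+2]) j" for i j
  proof
    assume "chain i (map h [1..<m+2]) j"
    from chain_bounds[OF this, of m] show False
      using h by (simp add: image_subset_iff del: upt_Suc)
  qed
  then have "eval A_inf h (word (map Var [1..<m+2])) = Null"
    by (intro elt_eqI, subst eval_word_eq_Intv) (auto simp: chain_Var simp del: map_map upt_Suc)
  then show "eval (A_fin m) h (fst (N_identity m)) = eval (A_fin m) h (snd (N_identity m))"
    unfolding N_identity_def eval_A_fin fst_conv snd_conv by simp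
qed

lemma valid_H:
  assumes "m \<ge> 1"
  shows "valid_in (A_fin m) (H_identity m)"
  unfolding valid_in_def
proof (intro allI impI)
  fix h :: "nat \<Rightarrow> elt"
  assume h: "\<forall>n. h n \<in> carrier (A_fin m)"
  let ?xs = "map h [1..<m+1]" and ?ys = "map (\<lambda>i. h (m + i)) [1..<m+1]"
  have eq: "?xs = ?ys" if "chain i ?xs j" "chain i ?ys j" for i j
  proof (rule chain_tight[OF that])
    \<comment> \<open>A chain of \<open>m\<close> factors with endpoints between 0 and
      \<open>m\<close> must run from 0 to \<open>m\<close>.\<close>
    show "j = i + length ?xs"
      using chain_bounds[OF that(1), of m] h assms by (simp add: image_subset_iff del: upt_Suc)
  qed (use h in auto)
  have "eval A_inf h (word (map Var [1..<m+1]) \<^bold>+ word (map (\<lambda>i. Var (m + i)) [1..<m+1])) =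
      eval A_inf h (word (map (\<lambda>i. Var i \<^bold>+ Var (m + i)) [1..<m+1]))"
  proof (rule elt_eqI)
    fix i j
    have "eval A_inf h (word (map Var [1..<m+1]) \<^bold>+ word (map (\<lambda>i. Var (m + i)) [1..<m+1])) = Intv i j
        \<longleftrightarrow> chain i ?xs j \<and> chain i ?ys j"
      using assms by (simp add: eval_word_eq_Intv comp_def del: upt_Suc)
    also have "\<dots> \<longleftrightarrow> ?xs = ?ys \<and> chain i ?xs j" using eq by metis
    also have "\<dots> \<longleftrightarrow> chain i (map (\<lambda>r. flat_add (h r) (h (m + r))) [1..<m+1]) j"
      by (rule chain_flat_add[symmetric])
    also have "\<dots> \<longleftrightarrow> eval A_inf h (word (map (\<lambda>i. Var i \<^bold>+ Var (m + i)) [1..<m+1])) = Intv i j"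
      using assms by (simp add: eval_word_eq_Intv comp_def del: upt_Suc)
    finally show "eval A_inf h (word (map Var [1..<m+1]) \<^bold>+ word (map (\<lambda>i. Var (m + i)) [1..<m+1])) = Intv i j
        \<longleftrightarrow> eval A_inf h (word (map (\<lambda>i. Var i \<^bold>+ Var (m + i)) [1..<m+1])) = Intv i j" .
  qed
  then show "eval (A_fin m) h (fst (H_identity m)) = eval (A_fin m) h (snd (H_identity m))"
    unfolding H_identity_def eval_A_fin fst_conv snd_conv .
qed

section \<open>Finiteness of the axiom sets\<close>

lemma finite_image_set4:
  assumes "finite A" "finite B" "finite C" "finite D"
  shows "finite {f a b c d | a b c d. a \<in> A \<and> b \<in> B \<and> c \<in> C \<and> d \<in> D}"
proof -
  have "{f a b c d | a b c d. a \<in> A \<and> b \<in> B \<and> c \<in> C \<and> d \<in> D} =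
      (\<Union>a\<in>A. \<Union>b\<in>B. \<Union>c\<in>C. (\<lambda>d. f a b c d) ` D)" by blast
  then show ?thesis using assms by simp
qed

lemma finite_C: "finite C_identities"
proof -
  have "finite M_identities"
    unfolding M_identities_def by (rule finite_image_set4) simp_all
  moreover have "finite L_identities" "finite E_identities"
    unfolding L_identities_def E_identities_def by (rule finite_image_set2; simp)+
  ultimately show ?thesis
    unfolding C_identities_def ai_semiring_axioms_def zero_axioms_def by simp
qed

section \<open>Completeness\<close>

primrec vars :: "trm \<Rightarrow> nat set" where
  "vars (Var n) = {n}"
| "vars \<^bold>0 = {}"
| "vars (s \<^bold>+ t) = vars s \<union> vars t"
| "vars (s \<^bold>* t) = vars s \<union> vars t"

text \<open>A single occurrence of zero makes the whole term derivably zero, but it leaves no trace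
  among the words of a sum, so it is recorded separately.\<close>

primrec has_zero :: "trm \<Rightarrow> bool" where
  "has_zero (Var n) = False"
| "has_zero \<^bold>0 = True"
| "has_zero (s \<^bold>+ t) = (has_zero s \<or> has_zero t)"
| "has_zero (s \<^bold>* t) = (has_zero s \<or> has_zero t)"

primrec words :: "trm \<Rightarrow> nat list set" where
  "words (Var n) = {[n]}"
| "words \<^bold>0 = {}"
| "words (s \<^bold>+ t) = words s \<union> words t"
| "words (s \<^bold>* t) = {u @ v | u v. u \<in> words s \<and> v \<in> words t}"

lemma finite_vars: "finite (vars t)"
  by (induction t) auto

lemma words_vars: "w \<in> words t \<Longrightarrow> set w \<subseteq> vars t"
  by (induction t arbitrary: w) fastforce+

lemma Nil_notin_words: "[] \<notin> words t"
  by (induction t) auto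

lemma words_nonempty: "\<not> has_zero t \<Longrightarrow> words t \<noteq> {}"
  by (induction t) auto

lemma eval_eq_IntvD:
  "eval A_inf h t = Intv i j \<Longrightarrow> \<not> has_zero t \<and> (\<forall>w\<in>words t. chain i (map h w) j)"
proof (induction t arbitrary: i j)
  case (Mul a b)
  then obtain k where "eval A_inf h a = Intv i k" "eval A_inf h b = Intv k j" by auto
  then show ?case using Mul.IH(1)[of i k] Mul.IH(2)[of k j] by (fastforce simp: chain_append)
qed auto

text \<open>In a product all pairs of words must be cut at one point: a fixed pair \<open>u\<close>,
  \<open>v\<close> supplies it, and pairing any other word with \<open>u\<close> or \<open>v\<close>
  forces the same cut.\<close>

lemma eval_eq_IntvI:
  "\<not> has_zero t \<Longrightarrow> \<forall>w\<in>words t. chain i (map h w) j \<Longrightarrow> eval A_inf h t = Intv i j"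
proof (induction t arbitrary: i j)
  case (Mul a b)
  obtain u v where uv: "u \<in> words a" "v \<in> words b"
    using Mul.prems words_nonempty by fastforce
  have all: "chain i (map h u' @ map h v') j" if "u' \<in> words a" "v' \<in> words b" for u' v'
  proof -
    have "u' @ v' \<in> words (a \<^bold>* b)" using that by auto
    from bspec[OF Mul.prems(2) this] show ?thesis by simp
  qed
  obtain k where k: "chain i (map h u) k" "chain k (map h v) j"
    using all[OF uv] by (auto simp: chain_append)
  have "chain i (map h u') k" if u': "u' \<in> words a" for u'
  proof -
    obtain l where l: "chain i (map h u') l" "chain l (map h v) j"
      using all[OF u' uv(2)] by (auto simp: chain_append)
    \<comment> \<open>The first letter of \<open>v\<close> determines where its chain
      starts.\<close>
    moreover have "v \<noteq> []" using uv Nil_notin_words by metis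
    ultimately have "l = k" using k by (cases v) auto
    then show ?thesis using l by simp
  qed
  moreover have "chain k (map h v') j" if v': "v' \<in> words b" for v'
  proof -
    obtain l where l: "chain i (map h u) l" "chain l (map h v') j"
      using all[OF uv(1) v'] by (auto simp: chain_append)
    then show ?thesis using chain_fun[OF k(1)] by auto
  qed
  ultimately show ?case using Mul.IH(1)[of i k] Mul.IH(2)[of k j] Mul.prems by auto
qed auto

context C_theory
begin

lemma word_below: "w \<in> words t \<Longrightarrow> word (map Var w) \<sqsubseteq> t"
proof (induction t arbitrary: w)
  case (Add a b)
  then show ?case using add_upper1 add_upper2 below_trans by (metis UnE words.simps(3))
next
  case (Mul a b)
  then obtain u v where uv: "w = u @ v" "u \<in> words a" "v \<in> words b" by auto
  then have "u \<noteq> []" "v \<noteq> []" using Nil_notin_words by metis+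
  then have "word (map Var u @ map Var v) \<sqsubseteq> word (map Var u) \<^bold>* word (map Var v)"
    by (intro eqv_imp_below word_append) auto
  also have "\<dots> \<sqsubseteq> a \<^bold>* b" by (intro mul_mono Mul.IH uv)
  finally show ?case using uv by simp
qed auto

lemma has_zero_imp_zero: "has_zero t \<Longrightarrow> \<^bold>0 \<sqsubseteq> t"
proof (induction t)
  case (Add a b)
  then show ?case using add_upper1 add_upper2 below_trans by (metis has_zero.simps(3))
next
  case (Mul a b)
  then have "\<^bold>0 \<sqsubseteq> word [a] \<or> \<^bold>0 \<sqsubseteq> word [b]" by auto
  then have "\<^bold>0 \<sqsubseteq> word [a, b]"
    using zero_infix[of "[a]" "[]" "[b]"] zero_infix[of "[b]" "[a]" "[]"] by auto
  then show ?case by (simp add: word_def)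
qed auto

text \<open>The contexts make the induction work: in a product each factor is expanded while the
  other stands in its context.\<close>

lemma below_if_words_below:
  assumes "\<not> has_zero t" "\<And>w. w \<in> words t \<Longrightarrow> word (as @ map Var w @ cs) \<sqsubseteq> s"
  shows "word (as @ [t] @ cs) \<sqsubseteq> s"
  using assms
proof (induction t arbitrary: as cs)
  case (Add a b)
  have sum: "word (as @ [a \<^bold>+ b] @ cs) \<sqsubseteq> word (as @ [a] @ cs) \<^bold>+ word (as @ [b] @ cs)"
  proof -
    have suffix: "word ([a \<^bold>+ b] @ cs) \<sqsubseteq> word ([a] @ cs) \<^bold>+ word ([b] @ cs)"
    proof (cases "cs = []")
      case False
      have "word ([a \<^bold>+ b] @ cs) \<sqsubseteq> (a \<^bold>+ b) \<^bold>* word cs"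
        using word_append[of "[a \<^bold>+ b]" cs] False by (simp add: eqv_imp_below)
      also have "\<dots> \<sqsubseteq> a \<^bold>* word cs \<^bold>+ b \<^bold>* word cs" by (rule eqv_imp_below[OF distrib_right])
      also have "\<dots> \<sqsubseteq> word ([a] @ cs) \<^bold>+ word ([b] @ cs)"
        using word_append[of "[a]" cs] word_append[of "[b]" cs] False
        by (intro add_least below_trans[OF _ add_upper1] below_trans[OF _ add_upper2])
          (simp_all add: eqv_imp_above)
      finally show ?thesis .
    qed simp
    show ?thesis
    proof (cases "as = []")
      case False
      have "word (as @ [a \<^bold>+ b] @ cs) \<sqsubseteq> word as \<^bold>* word ([a \<^bold>+ b] @ cs)"
        by (intro eqv_imp_below word_append False) simp
      also have "\<dots> \<sqsubseteq> word as \<^bold>* (word ([a] @ cs) \<^bold>+ word ([b] @ cs))"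
        by (intro mul_mono suffix below_refl)
      also have "\<dots> \<sqsubseteq> word as \<^bold>* word ([a] @ cs) \<^bold>+ word as \<^bold>* word ([b] @ cs)"
        by (rule eqv_imp_below[OF distrib_left])
      also have "\<dots> \<sqsubseteq> word (as @ [a] @ cs) \<^bold>+ word (as @ [b] @ cs)"
        using word_append[of as "[a] @ cs"] word_append[of as "[b] @ cs"] False
        by (intro add_least below_trans[OF _ add_upper1] below_trans[OF _ add_upper2])
          (simp_all add: eqv_imp_above)
      finally show ?thesis .
    qed (use suffix in simp)
  qed
  show ?case using Add by (intro below_trans[OF sum] add_least) auto
next
  case (Mul a b)
  have "word (as @ [a \<^bold>* b] @ cs) \<sqsubseteq> word (as @ [a, b] @ cs)"
    by (rule word_mono_infix) (simp_all add: word_def)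
  also have "word (as @ [a] @ (b # cs)) \<sqsubseteq> s"
  proof (rule Mul.IH(1))
    fix u assume u: "u \<in> words a"
    have "word ((as @ map Var u) @ [b] @ cs) \<sqsubseteq> s"
    proof (rule Mul.IH(2))
      fix v assume "v \<in> words b"
      then show "word ((as @ map Var u) @ map Var v @ cs) \<sqsubseteq> s"
        using Mul.prems(2)[of "u @ v"] u by auto
    qed (use Mul.prems in simp)
    then show "word (as @ map Var u @ b # cs) \<sqsubseteq> s" by simp
  qed (use Mul.prems in simp)
  then have "word (as @ [a, b] @ cs) \<sqsubseteq> s" by simp
  finally show ?case .
qed auto

section \<open>The language of absorbed words\<close>

definition sat :: "trm \<Rightarrow> nat list set" where
  "sat s = {w. w \<noteq> [] \<and> set w \<subseteq> vars s \<and> word (map Var w) \<sqsubseteq> s}"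

lemma words_subset_sat: "words s \<subseteq> sat s"
proof
  fix w assume w: "w \<in> words s"
  then have "w \<noteq> []" using Nil_notin_words by metis
  then show "w \<in> sat s" using w words_vars word_below by (simp add: sat_def)
qed

lemma distinct_sat:
  assumes "\<not> \<^bold>0 \<sqsubseteq> s" "w \<in> sat s"
  shows "distinct w"
proof (rule ccontr)
  assume "\<not> distinct w"
  then obtain a x b c where "w = a @ [x] @ b @ [x] @ c"
    by (metis not_distinct_decomp)
  then show False
    using repeated_below[of "map Var a" "Var x" "map Var b" "map Var c" s] assms
    by (simp add: sat_def)
qed

text \<open>Restricting \<open>sat\<close> to the letters of \<open>s\<close> bounds its words,
  since no letter repeats. Over \<open>A_inf\<close> this takes the place of (N).\<close>

lemma length_sat:
  assumes "\<not> \<^bold>0 \<sqsubseteq> s" "w \<in> sat s"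
  shows "length w \<le> card (vars s)"
proof -
  have "length w = card (set w)" using distinct_sat[OF assms] by (simp add: distinct_card)
  also have "\<dots> \<le> card (vars s)"
    using assms(2) by (intro card_mono finite_vars) (auto simp: sat_def)
  finally show ?thesis .
qed

lemma path_language_sat:
  assumes nz: "\<not> \<^bold>0 \<sqsubseteq> s"
    and length_le: "\<And>w. w \<in> sat s \<Longrightarrow> length w \<le> m"
    and cross: "\<And>u v u' v'. u @ v \<in> sat s \<Longrightarrow> u' @ v' \<in> sat s \<Longrightarrow> length u = length u' \<Longrightarrow>
      length v = length v' \<Longrightarrow> length (u @ v) = m \<Longrightarrow> word (map Var (u' @ v)) \<sqsubseteq> s"
  shows "path_language (sat s) m"
proof
  show "sat s \<noteq> {}"
    using words_subset_sat words_nonempty has_zero_imp_zero nz by blast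
  show "[] \<notin> sat s" by (simp add: sat_def)
next
  fix u x v p q assume "u @ x # v \<in> sat s" "p @ x # q \<in> sat s"
  then show "u @ x # q \<in> sat s"
    using M_below[of "map Var u" "Var x" "map Var v" s "map Var p" "map Var q"]
    by (auto simp: sat_def)
next
  fix u v p q :: "nat list"
  assume W: "u @ v \<in> sat s" "p @ v \<in> sat s" "p @ q \<in> sat s"
    and ne: "u \<noteq> []" "v \<noteq> []" "p \<noteq> []" "q \<noteq> []"
  have split: "word (map Var (a @ b)) \<sim> word (map Var a) \<^bold>* word (map Var b)"
    if "a \<noteq> []" "b \<noteq> []" for a b
    using word_append[of "map Var a" "map Var b"] that by simp
  have mul_below: "word (map Var a) \<^bold>* word (map Var b) \<sqsubseteq> s"
    if "a @ b \<in> sat s" "a \<noteq> []" "b \<noteq> []" for a b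
    using below_trans[OF eqv_imp_above[OF split]] that by (simp add: sat_def)
  have "word (map Var u) \<^bold>* word (map Var q) \<sqsubseteq> s"
    by (rule R_below[OF mul_below[OF W(1)] mul_below[OF W(2)] mul_below[OF W(3)]]) fact+
  then have "word (map Var (u @ q)) \<sqsubseteq> s"
    using below_trans[OF eqv_imp_below[OF split]] ne by blast
  then show "u @ q \<in> sat s" using W ne by (auto simp: sat_def)
next
  fix x u v z assume "x # u \<in> sat s" "v @ x # z \<in> sat s"
  then show "v = []"
    using L_below[of "Var x" "map Var u" s "map Var v" "map Var z"] nz by (auto simp: sat_def)
next
  fix u x v z assume "u @ [x] \<in> sat s" "v @ x # z \<in> sat s"
  then show "z = []"
    using E_below[of "map Var u" "Var x" s "map Var v" "map Var z"] nz by (auto simp: sat_def)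
next
  fix u v u' v'
  assume "u @ v \<in> sat s" "u' @ v' \<in> sat s" "length u = length u'" "length v = length v'"
    "length (u @ v) = m"
  then show "u' @ v \<in> sat s"
    using cross[of u v u' v'] by (auto simp: sat_def)
qed (rule length_le)

text \<open>Under the assignment of a potential all words of \<open>s\<close> share one nonzero
  value. Validity passes it to \<open>t\<close>, hence to every word of \<open>t\<close>, and
  \<open>mem_if_chain\<close> shows that these are absorbed by \<open>s\<close>.\<close>

lemma below_if_valid:
  assumes nz: "\<not> \<^bold>0 \<sqsubseteq> s" and path: "path_language (sat s) m" and valid: "valid_in (A_fin m) (s \<approx> t)"
  shows "t \<sqsubseteq> s"
proof -
  interpret path_language "sat s" m by (rule path)
  have eval_t: "eval A_inf (assignment \<phi>) t = Intv (\<phi> (Res [])) (\<phi> {[]})" if "potential \<phi>" for \<phi>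
  proof -
    have "eval A_inf (assignment \<phi>) s = Intv (\<phi> (Res [])) (\<phi> {[]})"
      using nz has_zero_imp_zero words_subset_sat chain_word by (intro eval_eq_IntvI) blast+
    then show ?thesis
      using valid assignment_carrier[OF that] by (auto simp: valid_in_def eval_A_fin)
  qed
  have "w \<in> sat s" if "w \<in> words t" for w
    using eval_eq_IntvD[OF eval_t] that by (intro mem_if_chain) blast
  moreover have "\<not> has_zero t"
    using eval_eq_IntvD[OF eval_t[OF potential_length]] by blast
  ultimately show ?thesis
    using below_if_words_below[of t "[]" "[]" s] by (auto simp: sat_def)
qed

text \<open>A side that is derivably zero is above everything, so a path language is required only
  for the other sides.\<close>

lemma eqv_if_valid:
  assumes path: "\<And>r. r \<in> {s, t} \<Longrightarrow> \<not> \<^bold>0 \<sqsubseteq> r \<Longrightarrow> path_language (sat r) m"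
    and valid: "valid_in (A_fin m) (s \<approx> t)"
  shows "s \<sim> t"
proof -
  have valid': "valid_in (A_fin m) (t \<approx> s)" using valid by (auto simp: valid_in_def)
  have "t \<sqsubseteq> s" if "\<not> \<^bold>0 \<sqsubseteq> s"
    using that path valid by (intro below_if_valid) auto
  moreover have "s \<sqsubseteq> t" if "\<not> \<^bold>0 \<sqsubseteq> t"
    using that path valid' by (intro below_if_valid) auto
  ultimately show ?thesis
    using below_antisym below_trans below_zero by metis
qed

section \<open>(N) and (H) for words\<close>

lemma N_below:
  assumes N: "N_identity m \<in> E" and "m < length w" "word (map Var w) \<sqsubseteq> s"
  shows "\<^bold>0 \<sqsubseteq> s"
proof -
  \<comment> \<open>Variables of (N) are numbered from 1, list positions from 0. Only the first
    \<open>m + 1\<close> letters are matched; the rest of \<open>w\<close> is context.\<close>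
  let ?\<sigma> = "\<lambda>i. Var (w ! (i - 1))"
  have "map ?\<sigma> [1..<m+2] = map Var (take (m + 1) w)"
    using assms(2) by (intro nth_equalityI) (auto simp del: upt_Suc)
  moreover have "subst ?\<sigma> (word (map Var [1..<m+2])) \<sim> subst ?\<sigma> \<^bold>0"
    using N unfolding N_identity_def by (rule derivable.ax)
  ultimately have "word (map Var (take (m + 1) w)) \<sim> \<^bold>0"
    by (subst (asm) subst_word) (simp_all add: comp_def del: upt_Suc)
  then have "\<^bold>0 \<sqsubseteq> word (map Var (take (m + 1) w))" by (simp add: eqv_zero_iff)
  then have "\<^bold>0 \<sqsubseteq> word ([] @ map Var (take (m + 1) w) @ map Var (drop (m + 1) w))"
    using assms(2) by (intro zero_infix) auto
  also have "\<dots> \<sqsubseteq> s" using assms(3) by (simp flip: map_append)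
  finally show ?thesis .
qed

lemma H_below:
  assumes H: "H_identity m \<in> E" and "m \<ge> 1" "length as = m" "length bs = m"
    and "word as \<sqsubseteq> s" "word bs \<sqsubseteq> s"
  shows "word (map2 (\<^bold>+) as bs) \<sqsubseteq> s"
proof -
  let ?\<sigma> = "\<lambda>i. if i \<le> m then as ! (i - 1) else bs ! (i - m - 1)"
  have lists: "map ?\<sigma> [1..<m+1] = as" "map (\<lambda>i. ?\<sigma> (m + i)) [1..<m+1] = bs"
    "map (\<lambda>i. ?\<sigma> i \<^bold>+ ?\<sigma> (m + i)) [1..<m+1] = map2 (\<^bold>+) as bs"
    using assms(3,4) by (intro nth_equalityI; auto simp del: upt_Suc)+
  have rule: "subst ?\<sigma> (word (map Var [1..<m+1]) \<^bold>+ word (map (\<lambda>i. Var (m + i)) [1..<m+1])) \<sim>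
      subst ?\<sigma> (word (map (\<lambda>i. Var i \<^bold>+ Var (m + i)) [1..<m+1]))"
    using H unfolding H_identity_def by (rule derivable.ax)
  have words: "subst ?\<sigma> (word (map f [1..<m+1])) = word (map (\<lambda>i. subst ?\<sigma> (f i)) [1..<m+1])" for f
    using assms(2) by (simp add: subst_word comp_def del: upt_Suc)
  have "word as \<^bold>+ word bs \<sim> word (map2 (\<^bold>+) as bs)"
    using rule unfolding subst.simps words lists .
  then show ?thesis
    using assms(5,6) add_least below_trans eqv_imp_above by blast
qed

end

section \<open>The identity bases\<close>

lemma basis_B_fin:
  assumes "m \<ge> 1"
  shows "is_identity_basis (A_fin m) (B_fin m)"
proof -
  interpret C_theory "B_fin m" by unfold_locales (auto simp: B_fin_def)
  have N: "N_identity m \<in> B_fin m" and H: "H_identity m \<in> B_fin m"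
    by (simp_all add: B_fin_def)
  have "path_language (sat s) m" if nz: "\<not> below \<^bold>0 s" for s
  proof (rule path_language_sat[OF nz])
    show "length w \<le> m" if "w \<in> sat s" for w
      using N_below[OF N, of w s] nz that by (force simp: sat_def)
  next
    fix u v u' v'
    assume *: "u @ v \<in> sat s" "u' @ v' \<in> sat s" "length u = length u'" "length v = length v'"
      "length (u @ v) = m"
    \<comment> \<open>(H) merges two absorbed words of length \<open>m\<close> into a product of
      letterwise sums. It lies above every word that picks one of the two letters at each position,
      such as \<open>u' @ v\<close>.\<close>
    let ?mix = "map2 (\<^bold>+) (map Var (u @ v)) (map Var (u' @ v'))"
    have "list_all2 below (map Var (u' @ v)) ?mix"
      using *(3,4) by (auto simp: list_all2_conv_all_nth nth_append add_upper1 add_upper2)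
    moreover have "map Var (u' @ v) \<noteq> []" using * assms by auto
    ultimately have "below (word (map Var (u' @ v))) (word ?mix)" by (rule word_mono)
    also have "below \<dots> s"
      using * assms by (intro H_below[OF H]) (auto simp: sat_def)
    finally show "below (word (map Var (u' @ v))) s" .
  qed
  then have "derivable (B_fin m) s t" if "valid_in (A_fin m) (s \<approx> t)" for s t
    using that by (intro eqv_if_valid) auto
  then show ?thesis
    unfolding is_identity_basis_def B_fin_def
    using valid_C valid_in_A_fin valid_N valid_H[OF assms] by (auto simp: B_fin_def)
qed

lemma basis_B_inf: "is_identity_basis A_inf B_inf"
proof -
  interpret C_theory B_inf by unfold_locales (auto simp: B_inf_def)
  have "derivable B_inf s t" if valid: "valid_in A_inf (s \<approx> t)" for s t
  proof (rule eqv_if_valid)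
    \<comment> \<open>The \<open>Suc\<close> makes all absorbed words of both sides strictly shorter
      than \<open>m\<close>, so the crossing condition is vacuous.\<close>
    define m where "m = Suc (card (vars s) + card (vars t))"
    show "valid_in (A_fin m) (s \<approx> t)" using valid by (rule valid_in_A_fin)
    fix r assume r: "r \<in> {s, t}" and nz: "\<not> below \<^bold>0 r"
    have less: "length w < m" if "w \<in> sat r" for w
      using length_sat[OF nz that] r by (auto simp: m_def)
    show "path_language (sat r) m"
      by (rule path_language_sat[OF nz]) (use less in fastforce)+
  qed
  then show ?thesis
    using valid_B_inf by (simp add: is_identity_basis_def)
qed

theorem theorem2p1:
  "(\<forall>m\<ge>1. finite (B_fin m) \<and> is_identity_basis (A_fin m) (B_fin m)) \<and>
   finite B_inf \<and> is_identity_basis A_inf B_inf"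
  using finite_C basis_B_fin basis_B_inf by (simp add: B_fin_def B_inf_def)

end
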